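(* Suppose assumptions (1)–(3) in the context hold, and consider the linear system $\frac{d}{dt}\widetilde{\bm x}=\widetilde{\bm A}\widetilde{\bm x}+\bm B\bm u$ in closed loop with the distributed control law $\bm u=\bm F_d\widetilde{\bm x}$, where $\widetilde{\bm A},\bm B,\bm F_d$ are as defined in the context and $\widetilde{\bm x}=\bm x-\bm x^*$. If $$\mathrm{spec}(\widetilde{\bm A}+\bm B\bm F_d)\subset\mathbb{C}^-=\{c\in\mathbb{C}\mid \mathrm{Re}(c)<0\},$$ then the synchronous state $\bm x^*$ (i.e. $\widetilde{\bm x}=\bm 0$) is globally asymptotically stable for this closed-loop linear system.
   Context: **Network.** $\mathcal V_H=\mathcal L_5\cup\mathcal L_4\cup\mathcal L_3$ (disjoint) is the node set of a rooted tree with $n_H=111$ nodes: $\mathcal L_5$ consists of the root, $\mathcal L_4$ of its 10 children, and $\mathcal L_3$ of 100 nodes, 10 children for each node of $\mathcal L_4$. $\mathcal E$ is the (symmetric) set of pairs of adjacent nodes; $\sum_{(j,i)\in\mathcal E}$ (for fixed $i$) is the sum over neighbours $j$ of $i$. Susceptances $b_{ij}$, conductances $g_{ij}$, $b_{ij}=0$ if $(i,j)\notin\mathcal E$; $\theta_{ij}=\theta_i-\theta_j$; $P_i,Q_i$ are real constants. **Synchronous state.** $\bm x^*$, with components $(\theta_i^*,\omega_i^*,v_i^* )$, satisfies $\omega_i^*=0$, $\sum_{(j,i)\in\mathcal E}b_{ij}v_i^*v_j^*\sin\theta_{ij}^*=P_i$, $-\sum_{(j,i)\in\mathcal E}b_{ij}v_i^*v_j^*\cos\theta_{ij}^*=Q_i-k_iv_i^*$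 for all $i\in\mathcal V_H$ (it is the equilibrium of the nonlinear system $\dot\theta_i=\omega_i$, $m_i\dot\omega_i=-d_i\omega_i+P_i-\sum_jb_{ij}v_iv_j\sin\theta_{ij}$, $\tau_i\dot v_i=-k_iv_i+Q_i+\sum_jb_{ij}v_iv_j\cos\theta_{ij}$). A reference node $g\in\mathcal L_3$ is fixed with $\theta_g=\theta_g^*$; $\widetilde{\bm x}\in\mathbb{R}^{3n_H-1}$ has blocks $\widetilde{\bm x}_i=(\theta_i-\theta_i^*,\omega_i,v_i-v_i^* )^\top$ for $i\neq g$ and $\widetilde{\bm x}_g=(\omega_g,v_g-v_g^* )^\top$. **Assumptions.** (1) The network is connected and lossless: $b_{ij}=b_{ji}>0$ for $(i,j)\in\mathcal E$, $b_{ii}=0$, $g_{ij}=0$. (2) $|\theta_i^*-\theta_j^*|<\pi/2$ for $(i,j)\in\mathcal E$. (3) $m_i,d_i,\tau_i,k_i,v_i^*>0$ for all $i$, and $m_i>m_j>m_k$ for all $i\in\mathcal L_5,j\in\mathcal L_4,k\in\mathcal L_3$. **Matrices.** $\widetilde{\bm A}=\bm A+\bm A^{\bm x}+\widehat{\bm A}\in\mathbb{R}^{(3n_H-1)\times(3n_H-1)}$, with $\bm A=\mathrm{diag}(\bm A_i)$, $\bm A^{\bm x}=\mathrm{diag}(\bm A_i^{\bm x})$ block diagonal, $\widehat{\bm A}=[\widehat{\bm A}_{ij}]$, and $\bm B=\mathrm{diag}(\bm B_i)\in\mathbb{R}^{(3n_H-1)\times2n_H}$, where $$\bm A_i=\begin{bmatrix}0&1&0\\0&-d_i/m_i&0\\0&0&-k_i/\tau_i\end{bmatrix},\quad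 \bm B_i=\begin{bmatrix}0&0\\1/m_i&0\\0&1/\tau_i\end{bmatrix},$$ $$\bm A_i^{\bm x}=\sum_{(j,i)\in\mathcal E}\begin{bmatrix}0&0&0\\-\frac{b_{ij}v_i^*v_j^*\cos\theta_{ij}^*}{m_i}&0&-\frac{b_{ij}v_j^*\sin\theta_{ij}^*}{m_i}\\-\frac{b_{ij}v_i^*v_j^*\sin\theta_{ij}^*}{\tau_i}&0&\frac{b_{ij}v_j^*\cos\theta_{ij}^*}{\tau_i}\end{bmatrix},$$ $$\widehat{\bm A}_{ij}=\begin{bmatrix}0&0&0\\\frac{b_{ij}v_i^*v_j^*\cos\theta_{ij}^*}{m_i}&0&-\frac{b_{ij}v_i^*\sin\theta_{ij}^*}{m_i}\\\frac{b_{ij}v_i^*v_j^*\sin\theta_{ij}^*}{\tau_i}&0&\frac{b_{ij}v_i^*\cos\theta_{ij}^*}{\tau_i}\end{bmatrix}\ \text{for }(i,j)\in\mathcal E,\quad \widehat{\bm A}_{ij}=0\ \text{otherwise}.$$ For the reference node $g$ the row and/or column belonging to $\theta_g$ is deleted from each block (e.g. $\bm A_g=\mathrm{diag}(-d_g/m_g,-k_g/\tau_g)$, $\bm B_g=\mathrm{diag}(1/m_g,1/\tau_g)$). $\widetilde{\bm A}$ is the Jacobian at $\bm x^*$ of the nonlinear system in the coordinates $\widetilde{\bm x}$ (with $\theta_g\equiv\theta_g^*$). **Distributed control law.** For each $i$, $\bm Q_{\bm u\bm u,i}\in\mathbb{R}^{2\times2}$ is a diagonal positive definite matrix and $\bm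 Q_{\bm x\bm x,i}=\bm C_i^\top\bm C_i$, with $\bm C_i=\mathrm{diag}(C_i^\theta,0,C_i^v)$, $C_i^\theta,C_i^v>0$ for $i\ne g$, and $\bm C_g$ a real diagonal $2\times2$ matrix. $\bm Q_i$ is a symmetric positive definite matrix ($3\times3$ for $i\neq g$, $2\times2$ for $i=g$) solving $$0=\bm Q_i\bm A_i+\bm A_i^\top\bm Q_i+\bm Q_{\bm x\bm x,i}-\bm Q_i\bm B_i\bm Q_{\bm u\bm u,i}^{-1}\bm B_i^\top\bm Q_i$$ and such that $\mathrm{spec}(\bm A_i+\bm B_i\bm F_{d,i})\subset\mathbb{C}^-$, where $\bm F_{d,i}=-\bm Q_{\bm u\bm u,i}^{-1}\bm B_i^\top\bm Q_i$. Then $\bm F_d=\mathrm{diag}(\bm F_{d,i})$ (block diagonal), i.e. $\bm u_i=\bm F_{d,i}\widetilde{\bm x}_i$. *)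

theory Defs
  imports
    Complex_Main
    "Jordan_Normal_Form.Spectral_Radius"
    "Jordan_Normal_Form.DL_Submatrix"
    "Jordan_Normal_Form.Gauss_Jordan_Elimination"
begin

section \<open>Global asymptotic stability\<close>

text \<open>Autonomous systems \<open>x' = f x\<close> on \<open>\<real>\<^sup>n\<close>, with \<open>\<real>\<^sup>n\<close> rendered as \<^term>\<open>carrier_vec n\<close>.\<close>

definition euclid_norm :: "real vec \<Rightarrow> real" where
  "euclid_norm x = sqrt (x \<bullet> x)"

definition is_solution :: "nat \<Rightarrow> (real vec \<Rightarrow> real vec) \<Rightarrow> (real \<Rightarrow> real vec) \<Rightarrow> bool" where
  "is_solution n f x \<longleftrightarrow>
     (\<forall>t\<ge>0. x t \<in> carrier_vec n \<and>
        (\<forall>i<n. ((\<lambda>s. x s $ i) has_real_derivative (f (x t) $ i)) (at t within {0..})))"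

text \<open>Stability and attractivity are quantified over all solutions, so the existence of a
  solution on \<open>[0,\<infinity>)\<close> from every initial state is required explicitly to keep them
  from holding vacuously.\<close>

definition globally_asymptotically_stable ::
    "nat \<Rightarrow> (real vec \<Rightarrow> real vec) \<Rightarrow> real vec \<Rightarrow> bool" where
  "globally_asymptotically_stable n f p \<longleftrightarrow>
     p \<in> carrier_vec n \<and> f p = 0\<^sub>v n \<and>
     (\<forall>x0\<in>carrier_vec n. \<exists>x. is_solution n f x \<and> x 0 = x0) \<and>
     (\<forall>\<epsilon>>0. \<exists>\<delta>>0. \<forall>x. is_solution n f x \<longrightarrow> euclid_norm (x 0 - p) < \<delta> \<longrightarrow>
        (\<forall>t\<ge>0. euclid_norm (x t - p) < \<epsilon>)) \<and>
     (\<forall>x. is_solution n f x \<longrightarrow> ((\<lambda>t. euclid_norm (x t - p)) \<longlongrightarrow> 0) at_top)"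


section \<open>Matrices\<close>

definition complex_spectrum :: "real mat \<Rightarrow> complex set" where
  "complex_spectrum M = spectrum (map_mat complex_of_real M)"

definition open_left_half_plane :: "complex set" ("\<complex>\<^sup>-") where
  "\<complex>\<^sup>- = {c. Re c < 0}"

definition sym_positive_definite :: "nat \<Rightarrow> real mat \<Rightarrow> bool" where
  "sym_positive_definite n M \<longleftrightarrow>
     M \<in> carrier_mat n n \<and> transpose_mat M = M \<and>
     (\<forall>x\<in>carrier_vec n. x \<noteq> 0\<^sub>v n \<longrightarrow> x \<bullet> (M *\<^sub>v x) > 0)"

text \<open>\<^const>\<open>mat_inverse\<close> returns \<^const>\<open>None\<close> on singular matrices; below it is only applied to
  positive definite ones.\<close>

definition mat_inv :: "real mat \<Rightarrow> real mat" where
  "mat_inv M = the (mat_inverse M)"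

text \<open>The square matrix with blocks \<open>M i j\<close> of size \<open>d i \<times> d j\<close>, for \<open>i\<close>, \<open>j\<close> ranging over the list
  \<open>vs\<close>; same row and column order as \<^const>\<open>diag_block_mat\<close>.\<close>

definition block_indices :: "'v list \<Rightarrow> ('v \<Rightarrow> nat) \<Rightarrow> ('v \<times> nat) list" where
  "block_indices vs d = concat (map (\<lambda>i. map (Pair i) [0..<d i]) vs)"

definition block_matrix :: "'v list \<Rightarrow> ('v \<Rightarrow> nat) \<Rightarrow> ('v \<Rightarrow> 'v \<Rightarrow> real mat) \<Rightarrow> real mat" where
  "block_matrix vs d M =
     (let ix = block_indices vs d in
      mat (length ix) (length ix)
        (\<lambda>(r, c). case (ix ! r, ix ! c) of ((i, a), (j, b)) \<Rightarrow> M i j $$ (a, b)))"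

lemma length_block_indices: "length (block_indices vs d) = (\<Sum>i\<leftarrow>vs. d i)"
  by (induction vs) (simp_all add: block_indices_def)

lemma block_matrix_carrier:
  "block_matrix vs d M \<in> carrier_mat (\<Sum>i\<leftarrow>vs. d i) (\<Sum>i\<leftarrow>vs. d i)"
  by (simp add: block_matrix_def Let_def length_block_indices)


section \<open>The network\<close>

text \<open>\<open>node_order\<close> is the order in which the nodes index the blocks of the system matrices.
  \<open>\<theta>s\<close>, \<open>\<omega>s\<close>, \<open>vs\<close> are the components of the synchronous state.\<close>

record 'v network =
  L5 :: "'v set"
  L4 :: "'v set"
  L3 :: "'v set"
  edges :: "('v \<times> 'v) set"
  node_order :: "'v list"
  ref_node :: 'v
  suscept :: "'v \<Rightarrow> 'v \<Rightarrow> real"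
  conduct :: "'v \<Rightarrow> 'v \<Rightarrow> real"
  inertia :: "'v \<Rightarrow> real"
  damping :: "'v \<Rightarrow> real"
  tau :: "'v \<Rightarrow> real"
  kv :: "'v \<Rightarrow> real"
  Pc :: "'v \<Rightarrow> real"
  Qc :: "'v \<Rightarrow> real"
  \<theta>s :: "'v \<Rightarrow> real"
  \<omega>s :: "'v \<Rightarrow> real"
  vs :: "'v \<Rightarrow> real"

definition nodes :: "'v network \<Rightarrow> 'v set" where
  "nodes N = L5 N \<union> L4 N \<union> L3 N"

definition n_H :: "'v network \<Rightarrow> nat" where
  "n_H N = card (nodes N)"

definition nbrs :: "'v network \<Rightarrow> 'v \<Rightarrow> 'v set" where
  "nbrs N i = {j. (j, i) \<in> edges N}"

definition three_level_tree :: "'v set \<Rightarrow> 'v set \<Rightarrow> 'v set \<Rightarrow> ('v \<times> 'v) set \<Rightarrow> bool" where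
  "three_level_tree A5 A4 A3 E \<longleftrightarrow>
     A5 \<inter> A4 = {} \<and> A5 \<inter> A3 = {} \<and> A4 \<inter> A3 = {} \<and>
     (\<exists>root parent.
        A5 = {root} \<and>
        card A4 = 10 \<and> (\<forall>j\<in>A4. parent j = root) \<and>
        card A3 = 100 \<and> (\<forall>k\<in>A3. parent k \<in> A4) \<and>
        (\<forall>j\<in>A4. card {k\<in>A3. parent k = j} = 10) \<and>
        E = {(i, parent i) | i. i \<in> A4 \<union> A3} \<union> {(parent i, i) | i. i \<in> A4 \<union> A3})"

definition hierarchical_network :: "'v network \<Rightarrow> bool" where
  "hierarchical_network N \<longleftrightarrow>
     three_level_tree (L5 N) (L4 N) (L3 N) (edges N) \<and>
     distinct (node_order N) \<and> set (node_order N) = nodes N \<and>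
     ref_node N \<in> L3 N \<and>
     (\<forall>i\<in>nodes N. \<forall>j\<in>nodes N. (i, j) \<notin> edges N \<longrightarrow> suscept N i j = 0)"

definition connected_lossless :: "'v network \<Rightarrow> bool" where
  "connected_lossless N \<longleftrightarrow>
     (\<forall>i\<in>nodes N. \<forall>j\<in>nodes N. (i, j) \<in> (edges N)\<^sup>*) \<and>
     (\<forall>(i, j)\<in>edges N. suscept N i j = suscept N j i \<and> suscept N i j > 0) \<and>
     (\<forall>i\<in>nodes N. suscept N i i = 0) \<and>
     (\<forall>i\<in>nodes N. \<forall>j\<in>nodes N. conduct N i j = 0)"

definition bounded_angle_differences :: "'v network \<Rightarrow> bool" where
  "bounded_angle_differences N \<longleftrightarrow> (\<forall>(i, j)\<in>edges N. \<bar>\<theta>s N i - \<theta>s N j\<bar> < pi / 2)"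

definition positive_parameters :: "'v network \<Rightarrow> bool" where
  "positive_parameters N \<longleftrightarrow>
     (\<forall>i\<in>nodes N. inertia N i > 0 \<and> damping N i > 0 \<and> tau N i > 0 \<and> kv N i > 0 \<and> vs N i > 0) \<and>
     (\<forall>i\<in>L5 N. \<forall>j\<in>L4 N. \<forall>k\<in>L3 N. inertia N i > inertia N j \<and> inertia N j > inertia N k)"

definition synchronous_state :: "'v network \<Rightarrow> bool" where
  "synchronous_state N \<longleftrightarrow>
     (\<forall>i\<in>nodes N.
        \<omega>s N i = 0 \<and>
        (\<Sum>j\<in>nbrs N i. suscept N i j * vs N i * vs N j * sin (\<theta>s N i - \<theta>s N j)) = Pc N i \<and>
        - (\<Sum>j\<in>nbrs N i. suscept N i j * vs N i * vs N j * cos (\<theta>s N i - \<theta>s N j))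
          = Qc N i - kv N i * vs N i)"


section \<open>System matrices\<close>

text \<open>The local state is \<open>(\<theta>, \<omega>, v)\<close>, with indices 0, 1, 2; the reference node has no angle.
  The blocks are obtained from the full ones by keeping the rows and columns in
  \<open>local_states\<close>.\<close>

definition local_states :: "'v network \<Rightarrow> 'v \<Rightarrow> nat set" where
  "local_states N i = (if i = ref_node N then {1, 2} else {0, 1, 2})"

definition local_dim :: "'v network \<Rightarrow> 'v \<Rightarrow> nat" where
  "local_dim N i = (if i = ref_node N then 2 else 3)"

definition A_blk :: "'v network \<Rightarrow> 'v \<Rightarrow> real mat" where
  "A_blk N i = submatrix
     (mat_of_rows_list 3
       [[0, 1, 0],
        [0, - damping N i / inertia N i, 0],
        [0, 0, - kv N i / tau N i]])
     (local_states N i) (local_states N i)"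

definition B_blk :: "'v network \<Rightarrow> 'v \<Rightarrow> real mat" where
  "B_blk N i = submatrix
     (mat_of_rows_list 2
       [[0, 0],
        [1 / inertia N i, 0],
        [0, 1 / tau N i]])
     (local_states N i) {0, 1}"

definition Ax_summand :: "'v network \<Rightarrow> 'v \<Rightarrow> 'v \<Rightarrow> real mat" where
  "Ax_summand N i j =
     (let b = suscept N i j; vi = vs N i; vj = vs N j;
          s = sin (\<theta>s N i - \<theta>s N j); c = cos (\<theta>s N i - \<theta>s N j);
          m = inertia N i; \<tau> = tau N i in
      mat_of_rows_list 3
       [[0, 0, 0],
        [- (b * vi * vj * c) / m, 0, - (b * vj * s) / m],
        [- (b * vi * vj * s) / \<tau>, 0, b * vj * c / \<tau>]])"

definition Ax_blk :: "'v network \<Rightarrow> 'v \<Rightarrow> real mat" where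
  "Ax_blk N i = submatrix
     (mat 3 3 (\<lambda>rc. \<Sum>j\<in>nbrs N i. Ax_summand N i j $$ rc))
     (local_states N i) (local_states N i)"

definition Ahat_blk :: "'v network \<Rightarrow> 'v \<Rightarrow> 'v \<Rightarrow> real mat" where
  "Ahat_blk N i j = submatrix
     (if (i, j) \<in> edges N then
       (let b = suscept N i j; vi = vs N i; vj = vs N j;
            s = sin (\<theta>s N i - \<theta>s N j); c = cos (\<theta>s N i - \<theta>s N j);
            m = inertia N i; \<tau> = tau N i in
        mat_of_rows_list 3
         [[0, 0, 0],
          [b * vi * vj * c / m, 0, - (b * vi * s) / m],
          [b * vi * vj * s / \<tau>, 0, b * vi * c / \<tau>]])
      else 0\<^sub>m 3 3)
     (local_states N i) (local_states N j)"

definition A_mat :: "'v network \<Rightarrow> real mat" where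
  "A_mat N = diag_block_mat (map (A_blk N) (node_order N))"

definition Ax_mat :: "'v network \<Rightarrow> real mat" where
  "Ax_mat N = diag_block_mat (map (Ax_blk N) (node_order N))"

definition Ahat_mat :: "'v network \<Rightarrow> real mat" where
  "Ahat_mat N = block_matrix (node_order N) (local_dim N) (Ahat_blk N)"

definition A_tilde :: "'v network \<Rightarrow> real mat" where
  "A_tilde N = A_mat N + Ax_mat N + Ahat_mat N"

definition B_mat :: "'v network \<Rightarrow> real mat" where
  "B_mat N = diag_block_mat (map (B_blk N) (node_order N))"


section \<open>Distributed control law\<close>

text \<open>\<open>C\<close>, \<open>Quu\<close> and \<open>Q\<close> are the families \<open>C\<^sub>i\<close>, \<open>Q\<^sub>u\<^sub>u\<^sub>,\<^sub>i\<close> and \<open>Q\<^sub>i\<close>.\<close>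

definition Fd_blk :: "'v network \<Rightarrow> ('v \<Rightarrow> real mat) \<Rightarrow> ('v \<Rightarrow> real mat) \<Rightarrow> 'v \<Rightarrow> real mat" where
  "Fd_blk N Quu Q i = - (mat_inv (Quu i) * transpose_mat (B_blk N i) * Q i)"

definition Fd_mat :: "'v network \<Rightarrow> ('v \<Rightarrow> real mat) \<Rightarrow> ('v \<Rightarrow> real mat) \<Rightarrow> real mat" where
  "Fd_mat N Quu Q = diag_block_mat (map (Fd_blk N Quu Q) (node_order N))"

definition output_weight :: "'v network \<Rightarrow> 'v \<Rightarrow> real mat \<Rightarrow> bool" where
  "output_weight N i Ci \<longleftrightarrow>
     (if i = ref_node N then Ci \<in> carrier_mat 2 2 \<and> diagonal_mat Ci
      else \<exists>c\<theta> cv. c\<theta> > 0 \<and> cv > 0 \<and>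
             Ci = mat_of_rows_list 3 [[c\<theta>, 0, 0], [0, 0, 0], [0, 0, cv]])"

definition riccati :: "real mat \<Rightarrow> real mat \<Rightarrow> real mat \<Rightarrow> real mat \<Rightarrow> real mat \<Rightarrow> bool" where
  "riccati Ai Bi Qxxi Quui Qi \<longleftrightarrow>
     0\<^sub>m (dim_row Ai) (dim_row Ai) =
       Qi * Ai + transpose_mat Ai * Qi + Qxxi - Qi * Bi * mat_inv Quui * transpose_mat Bi * Qi"

definition distributed_control_law ::
    "'v network \<Rightarrow> ('v \<Rightarrow> real mat) \<Rightarrow> ('v \<Rightarrow> real mat) \<Rightarrow> ('v \<Rightarrow> real mat) \<Rightarrow> bool" where
  "distributed_control_law N C Quu Q \<longleftrightarrow>
     (\<forall>i\<in>nodes N.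
        diagonal_mat (Quu i) \<and> sym_positive_definite 2 (Quu i) \<and>
        output_weight N i (C i) \<and>
        sym_positive_definite (local_dim N i) (Q i) \<and>
        riccati (A_blk N i) (B_blk N i) (transpose_mat (C i) * C i) (Quu i) (Q i) \<and>
        complex_spectrum (A_blk N i + B_blk N i * Fd_blk N Quu Q i) \<subseteq> \<complex>\<^sup>-)"


section \<open>Dimensions\<close>

lemma card_below_3: "card {a. a < (3::nat) \<and> a \<in> local_states N i} = local_dim N i"
proof -
  have "{a. a < (3::nat) \<and> a \<in> local_states N i} = local_states N i"
    by (auto simp: local_states_def split: if_splits)
  thus ?thesis by (simp add: local_states_def local_dim_def)
qed

lemma blk_carrier:
  "A_blk N i \<in> carrier_mat (local_dim N i) (local_dim N i)"
  "Ax_blk N i \<in> carrier_mat (local_dim N i) (local_dim N i)"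
  "Ahat_blk N i j \<in> carrier_mat (local_dim N i) (local_dim N j)"
  "B_blk N i \<in> carrier_mat (local_dim N i) 2"
proof -
  show "A_blk N i \<in> carrier_mat (local_dim N i) (local_dim N i)"
    by (rule carrier_matI)
      (simp_all add: A_blk_def dim_submatrix mat_of_rows_list_def
          card_below_3 card_below_3[unfolded numeral_3_eq_3])
  show "Ax_blk N i \<in> carrier_mat (local_dim N i) (local_dim N i)"
    by (rule carrier_matI) (simp_all add: Ax_blk_def dim_submatrix card_below_3)
  show "Ahat_blk N i j \<in> carrier_mat (local_dim N i) (local_dim N j)"
    by (rule carrier_matI)
      (simp_all add: Ahat_blk_def dim_submatrix mat_of_rows_list_def Let_def
          card_below_3 card_below_3[unfolded numeral_3_eq_3])
  have "{a. a < Suc (Suc 0) \<and> a \<in> {0, 1}} = {0, 1}" by auto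
  hence "card {a. a < Suc (Suc 0) \<and> a \<in> {0, 1}} = 2" by simp
  thus "B_blk N i \<in> carrier_mat (local_dim N i) 2"
    by (intro carrier_matI)
      (simp_all add: B_blk_def dim_submatrix mat_of_rows_list_def
          card_below_3[unfolded numeral_3_eq_3] numeral_2_eq_2)
qed

lemma n_H_eq: "hierarchical_network N \<Longrightarrow> n_H N = 111"
proof -
  assume "hierarchical_network N"
  then have d: "L5 N \<inter> L4 N = {}" "L5 N \<inter> L3 N = {}" "L4 N \<inter> L3 N = {}"
    and c: "card (L5 N) = 1" "card (L4 N) = 10" "card (L3 N) = 100"
    by (auto simp: hierarchical_network_def three_level_tree_def)
  have f: "finite (L5 N)" "finite (L4 N)" "finite (L3 N)"
    using c by (auto intro: card_ge_0_finite)
  have "card (L5 N \<union> L4 N) = 11" using card_Un_disjoint[OF f(1,2) d(1)] c by simp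
  moreover have "(L5 N \<union> L4 N) \<inter> L3 N = {}" using d by blast
  ultimately show ?thesis
    using card_Un_disjoint[of "L5 N \<union> L4 N" "L3 N"] f c by (simp add: n_H_def nodes_def)
qed

lemma sum_local_dim:
  assumes "hierarchical_network N"
  shows "(\<Sum>i\<leftarrow>node_order N. local_dim N i) = 3 * n_H N - 1"
proof -
  let ?g = "ref_node N"
  have d: "distinct (node_order N)" and s: "set (node_order N) = nodes N" and g: "?g \<in> nodes N"
    using assms by (auto simp: hierarchical_network_def nodes_def)
  have fin: "finite (nodes N)" using s by (metis List.finite_set)
  have "(\<Sum>i\<leftarrow>node_order N. local_dim N i) = (\<Sum>i\<in>nodes N. local_dim N i)"
    using sum_list_distinct_conv_sum_set[OF d] s by simp
  also have "\<dots> = local_dim N ?g + (\<Sum>i\<in>nodes N - {?g}. local_dim N i)"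
    using sum.remove[OF fin g] .
  also have "(\<Sum>i\<in>nodes N - {?g}. local_dim N i) = (\<Sum>i\<in>nodes N - {?g}. 3)"
    by (rule sum.cong) (auto simp: local_dim_def)
  also have "\<dots> = 3 * (n_H N - 1)" using g fin by (simp add: n_H_def)
  finally show ?thesis using n_H_eq[OF assms] by (simp add: local_dim_def)
qed

lemma system_matrix_carriers:
  assumes "hierarchical_network N"
  shows "A_tilde N \<in> carrier_mat (3 * n_H N - 1) (3 * n_H N - 1)"
    and "B_mat N \<in> carrier_mat (3 * n_H N - 1) (2 * n_H N)"
proof -
  have [simp]: "dim_row (A_blk N i) = local_dim N i" "dim_col (A_blk N i) = local_dim N i"
    "dim_row (Ax_blk N i) = local_dim N i" "dim_col (Ax_blk N i) = local_dim N i"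
    "dim_row (B_blk N i) = local_dim N i" "dim_col (B_blk N i) = 2" for i
    using blk_carrier(1,2,4)[of N i] by auto
  have len: "length (node_order N) = n_H N"
    using assms by (metis distinct_card hierarchical_network_def n_H_def)
  have "A_mat N \<in> carrier_mat (3 * n_H N - 1) (3 * n_H N - 1)"
    "Ax_mat N \<in> carrier_mat (3 * n_H N - 1) (3 * n_H N - 1)"
    "Ahat_mat N \<in> carrier_mat (3 * n_H N - 1) (3 * n_H N - 1)"
    using sum_local_dim[OF assms] block_matrix_carrier[of "node_order N" "local_dim N"]
    by (auto intro!: carrier_matI
        simp: A_mat_def Ax_mat_def Ahat_mat_def dim_diag_block_mat comp_def)
  then show "A_tilde N \<in> carrier_mat (3 * n_H N - 1) (3 * n_H N - 1)"
    by (simp add: A_tilde_def)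
  show "B_mat N \<in> carrier_mat (3 * n_H N - 1) (2 * n_H N)"
    using sum_local_dim[OF assms] len
    by (auto intro!: carrier_matI
        simp: B_mat_def dim_diag_block_mat comp_def sum_list_triv)
qed

end

theory Submission
  imports Defs
begin

text \<open>
  Only the spectral condition on the closed-loop matrix \<open>M\<close> matters. Schur triangularisation over
  \<open>\<complex>\<close> turns \<open>M\<close> into an upper triangular \<open>T\<close> whose diagonal has negative real part, and a diagonal
  scaling by powers of a small \<open>e\<close> makes the off-diagonal part negligible against it. The scaled
  squared norm in the triangular coordinates is therefore a Lyapunov function that decays
  exponentially along every solution. Solutions exist because the exponential series
  \<open>\<Sum>k. M\<^sup>k x\<^sub>0 t\<^sup>k / k!\<close> converges and can be differentiated termwise.
\<close>

section \<open>Triangular matrices: dissipation in a weighted norm\<close>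

text \<open>In the coordinates \<open>y i / e ^ i\<close> an entry \<open>t i j\<close> with
  \<open>i < j\<close> acquires the factor \<open>e ^ (j - i)\<close>, while the diagonal is
  unchanged; a small \<open>e\<close> leaves half of the diagonal decay. The left-hand side is half
  the derivative of the weighted squared norm along \<open>y' = t y\<close>.\<close>

lemma upper_triangular_weighted_dissipation:
  fixes t :: "nat \<Rightarrow> nat \<Rightarrow> complex"
  assumes tri: "\<And>i j. i < n \<Longrightarrow> j < i \<Longrightarrow> t i j = 0"
    and neg: "\<And>i. i < n \<Longrightarrow> Re (t i i) < 0"
  obtains w :: "nat \<Rightarrow> real" and \<alpha> :: real
  where "\<And>i. w i > 0" "\<alpha> > 0"
    "\<And>y. (\<Sum>i<n. w i * Re (cnj (y i) * (\<Sum>j<n. t i j * y j)))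
        \<le> - \<alpha> * (\<Sum>i<n. w i * (cmod (y i))\<^sup>2)"
proof -
  \<comment> \<open>A common decay rate for the diagonal; the inserted 1 keeps the set nonempty when
    \<open>n = 0\<close>.\<close>
  define a where "a = Min (insert 1 ((\<lambda>i. - Re (t i i)) ` {..<n}))"
  have a: "a > 0" unfolding a_def using neg by (subst Min_gr_iff) auto
  have diag: "Re (t i i) \<le> - a" if "i < n" for i
  proof -
    have "a \<le> - Re (t i i)" unfolding a_def using that by (intro Min_le) auto
    then show ?thesis by simp
  qed
  define K where "K = (\<Sum>i<n. \<Sum>j<n. cmod (t i j))"
  have K0: "K \<ge> 0" unfolding K_def by (intro sum_nonneg) auto
  have K: "cmod (t i j) \<le> K" if "i < n" "j < n" for i j
  proof -
    have "cmod (t i j) \<le> (\<Sum>j<n. cmod (t i j))"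
      using that by (intro member_le_sum) auto
    also have "\<dots> \<le> K" unfolding K_def
      using that by (intro member_le_sum[of i _ "\<lambda>i. \<Sum>j<n. cmod (t i j)"]) (auto intro: sum_nonneg)
    finally show ?thesis .
  qed
  \<comment> \<open>Chosen so that \<open>e * K * n \<le> a / 2\<close>; the \<open>+ 1\<close>
    avoids division by zero, and the cap at 1 gives \<open>e ^ Suc k \<le> e\<close>.\<close>
  define e where "e = min 1 (a / (2 * (K * n + 1)))"
  have Kn: "K * n + 1 > 0" using K0 by (simp add: add_nonneg_pos)
  have e: "e > 0" "e \<le> 1" using a Kn by (auto simp: e_def)
  have "e * (K * n + 1) \<le> a / (2 * (K * n + 1)) * (K * n + 1)"
    using Kn by (intro mult_right_mono) (auto simp: e_def)
  also have "\<dots> = a / 2" using Kn by (simp add: field_simps)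
  finally have eK: "e * K * n \<le> a / 2" using e by (simp add: algebra_simps)
  define w :: "nat \<Rightarrow> real" where "w i = 1 / (e ^ i)\<^sup>2" for i
  have w: "w i > 0" for i using e by (simp add: w_def)
  show ?thesis
  proof (rule that[of w "a / 2"])
    fix y :: "nat \<Rightarrow> complex"
    define u where "u i = cmod (y i) / e ^ i" for i
    have u0: "u i \<ge> 0" for i using e by (simp add: u_def)
    have yu: "cmod (y i) = e ^ i * u i" for i using e by (simp add: u_def)
    have wy: "w i * (cmod (y i))\<^sup>2 = (u i)\<^sup>2" for i
      using e by (simp add: w_def u_def power_divide)
    define S where "S = (\<Sum>i<n. (u i)\<^sup>2)"
    have S0: "S \<ge> 0" unfolding S_def by (intro sum_nonneg) auto
    \<comment> \<open>The error term is granted to every pair, even for \<open>j \<le> i\<close>, so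
      that the double sum has a closed form.\<close>
    have pair: "w i * Re (cnj (y i) * (t i j * y j))
        \<le> (if j = i then - a * (u i)\<^sup>2 else 0) + e * K * ((u i)\<^sup>2 + (u j)\<^sup>2) / 2"
      if "i < n" "j < n" for i j
    proof -
      have pos: "0 \<le> e * K * ((u i)\<^sup>2 + (u j)\<^sup>2) / 2" using e K0 by simp
      consider "j < i" | "j = i" | "i < j" by linarith
      then show ?thesis
      proof cases
        case 1
        then show ?thesis using tri[OF that(1)] pos by simp
      next
        case 2
        have "Re (cnj (y i) * (t i i * y i)) = Re (t i i) * (cmod (y i))\<^sup>2"
          unfolding cmod_power2 by (simp add: algebra_simps power2_eq_square)
        then have "w i * Re (cnj (y i) * (t i i * y i)) = Re (t i i) * (u i)\<^sup>2"
          using wy[of i] by (simp add: mult.left_commute)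
        also have "\<dots> \<le> - a * (u i)\<^sup>2" using diag[OF that(1)] by (intro mult_right_mono) auto
        finally show ?thesis using 2 pos by simp
      next
        case 3
        then obtain k where k: "j = i + Suc k" using less_imp_Suc_add by auto
        have "w i * Re (cnj (y i) * (t i j * y j)) \<le> w i * cmod (cnj (y i) * (t i j * y j))"
          using w[of i] by (intro mult_left_mono complex_Re_le_cmod) simp
        also have "\<dots> = w i * (cmod (t i j) * (cmod (y i) * cmod (y j)))"
          by (simp add: norm_mult mult_ac)
        also have "\<dots> \<le> w i * (K * (cmod (y i) * cmod (y j)))"
          using w[of i] K[OF that] by (intro mult_left_mono mult_right_mono) auto
        \<comment> \<open>\<open>w i\<close> contributes \<open>e\<close> to the power
          \<open>- 2 i\<close> and the two moduli contribute \<open>e ^ (i + j)\<close>, leaving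
          \<open>e ^ (j - i)\<close>.\<close>
        also have "\<dots> = e ^ Suc k * (K * (u i * u j))"
          using e by (simp add: yu w_def k power_add power2_eq_square field_simps)
        also have "\<dots> \<le> e * (K * (u i * u j))"
          using e K0 u0 power_le_one[of e k] by (intro mult_right_mono) (auto simp: mult_le_cancel_left1)
        also have "\<dots> = e * K * (u i * u j)" by simp
        also have "\<dots> \<le> e * K * (((u i)\<^sup>2 + (u j)\<^sup>2) / 2)"
          using e K0 sum_squares_bound[of "u i" "u j"] by (intro mult_left_mono) auto
        finally show ?thesis using 3 by simp
      qed
    qed
    have "(\<Sum>i<n. w i * Re (cnj (y i) * (\<Sum>j<n. t i j * y j)))
        = (\<Sum>i<n. \<Sum>j<n. w i * Re (cnj (y i) * (t i j * y j)))"
      by (simp only: sum_distrib_left Re_sum)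
    also have "\<dots> \<le> (\<Sum>i<n. \<Sum>j<n. (if j = i then - a * (u i)\<^sup>2 else 0)
        + e * K * ((u i)\<^sup>2 + (u j)\<^sup>2) / 2)"
      by (intro sum_mono pair) auto
    also have "\<dots> = (\<Sum>i<n. - a * (u i)\<^sup>2 + e * K / 2 * (n * (u i)\<^sup>2 + S))"
    proof (rule sum.cong[OF refl])
      fix i assume "i \<in> {..<n}"
      then have "(\<Sum>j<n. if j = i then - a * (u i)\<^sup>2 else 0) = - a * (u i)\<^sup>2" by simp
      moreover have "(\<Sum>j<n. e * K * ((u i)\<^sup>2 + (u j)\<^sup>2) / 2)
          = e * K / 2 * (\<Sum>j<n. (u i)\<^sup>2 + (u j)\<^sup>2)"
        unfolding sum_distrib_left by (rule sum.cong) auto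
      ultimately show "(\<Sum>j<n. (if j = i then - a * (u i)\<^sup>2 else 0)
          + e * K * ((u i)\<^sup>2 + (u j)\<^sup>2) / 2) = - a * (u i)\<^sup>2 + e * K / 2 * (n * (u i)\<^sup>2 + S)"
        by (simp only: sum.distrib S_def) simp
    qed
    \<comment> \<open>Each square is counted \<open>n\<close> times as a row term and
      \<open>n\<close> times as a column term.\<close>
    also have "\<dots> = - a * S + e * K / 2 * (n * S + n * S)"
      unfolding sum.distrib sum_distrib_left[symmetric] S_def[symmetric] by simp
    also have "\<dots> = - a * S + e * K * n * S" by simp
    also have "\<dots> \<le> - a * S + a / 2 * S"
      using eK S0 by (intro add_left_mono mult_right_mono) auto
    finally show "(\<Sum>i<n. w i * Re (cnj (y i) * (\<Sum>j<n. t i j * y j)))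
        \<le> - (a / 2) * (\<Sum>i<n. w i * (cmod (y i))\<^sup>2)"
      by (simp add: wy S_def)
  qed (use w a in auto)
qed

section \<open>Norm comparison and the quadratic Lyapunov function\<close>

lemma mult_mat_vec_index:
  assumes "A \<in> carrier_mat m n" "v \<in> carrier_vec n" "i < m"
  shows "(A *\<^sub>v v) $ i = (\<Sum>j<n. A $$ (i, j) * v $ j)"
  using assms by (simp add: scalar_prod_def row_def lessThan_atLeast0)

lemma euclid_norm_sq: "v \<in> carrier_vec n \<Longrightarrow> (euclid_norm v)\<^sup>2 = (\<Sum>i<n. (v $ i)\<^sup>2)"
  by (simp add: euclid_norm_def scalar_prod_def lessThan_atLeast0 sum_nonneg power2_eq_square)

lemma euclid_norm_nonneg: "euclid_norm v \<ge> 0"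
  by (simp add: euclid_norm_def scalar_prod_def sum_nonneg)

text \<open>Carries a uniform coordinate bound through one matrix row by the triangle inequality;
  applied to \<open>P\<close> and \<open>R\<close> below, it makes the Lyapunov function comparable
  to the squared Euclidean norm.\<close>

lemma cmod_sum_mult_sq_le:
  fixes a u :: "nat \<Rightarrow> complex"
  assumes "\<And>j. j < n \<Longrightarrow> (cmod (u j))\<^sup>2 \<le> B"
  shows "(cmod (\<Sum>j<n. a j * u j))\<^sup>2 \<le> (\<Sum>j<n. cmod (a j))\<^sup>2 * B"
\<comment> \<open>For \<open>n = 0\<close> the bound \<open>B\<close> may be negative, but both
  sides vanish; otherwise \<open>B \<ge> 0\<close> and \<open>sqrt B\<close> is usable.\<close>
proof (cases "n = 0")
  case False
  then have B: "B \<ge> 0" using assms[of 0] by (meson le_less_trans not_gr0 not_le zero_le_power2)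
  have "cmod (\<Sum>j<n. a j * u j) \<le> (\<Sum>j<n. cmod (a j) * cmod (u j))"
    by (simp add: order_trans[OF norm_sum] norm_mult)
  also have "\<dots> \<le> (\<Sum>j<n. cmod (a j) * sqrt B)"
    using assms by (intro sum_mono mult_left_mono real_le_rsqrt) auto
  also have "\<dots> = (\<Sum>j<n. cmod (a j)) * sqrt B" by (simp add: sum_distrib_right)
  finally show ?thesis
    using B power_mono[of "cmod (\<Sum>j<n. a j * u j)" "(\<Sum>j<n. cmod (a j)) * sqrt B" 2]
    by (simp add: power_mult_distrib)
qed simp

text \<open>\<open>R\<close> maps to Schur coordinates, so the Lyapunov function is a weighted norm in those.\<close>
lemma hurwitz_lyapunov:
  assumes M: "M \<in> carrier_mat n n" and spec: "complex_spectrum M \<subseteq> \<complex>\<^sup>-"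
  obtains R :: "complex mat" and w :: "nat \<Rightarrow> real" and \<alpha> c\<^sub>1 c\<^sub>2 :: real
  where "R \<in> carrier_mat n n" "\<alpha> > 0" "c\<^sub>1 > 0" "c\<^sub>2 > 0"
    "\<And>x. x \<in> carrier_vec n \<Longrightarrow>
       (\<Sum>i<n. w i * Re (cnj ((R *\<^sub>v map_vec of_real x) $ i) * (R *\<^sub>v map_vec of_real (M *\<^sub>v x)) $ i))
         \<le> - \<alpha> * (\<Sum>i<n. w i * (cmod ((R *\<^sub>v map_vec of_real x) $ i))\<^sup>2)"
    "\<And>x. x \<in> carrier_vec n \<Longrightarrow>
       (euclid_norm x)\<^sup>2 \<le> c\<^sub>1 * (\<Sum>i<n. w i * (cmod ((R *\<^sub>v map_vec of_real x) $ i))\<^sup>2)"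
    "\<And>x. x \<in> carrier_vec n \<Longrightarrow>
       (\<Sum>i<n. w i * (cmod ((R *\<^sub>v map_vec of_real x) $ i))\<^sup>2) \<le> c\<^sub>2 * (euclid_norm x)\<^sup>2"
proof -
  let ?M = "map_mat complex_of_real M"
  have M': "?M \<in> carrier_mat n n" using M by simp
  obtain es where "char_poly ?M = (\<Prod>a\<leftarrow>es. [:- a, 1:])"
    using char_poly_factorized[OF M'] by blast
  then obtain T where T: "T \<in> carrier_mat n n" "upper_triangular T" "similar_mat ?M T"
    using schur_decomposition_exists[OF M'] by blast
  from T(3) obtain P R where "similar_mat_wit ?M T P R" unfolding similar_mat_def by blast
  note wit = similar_mat_witD[OF M'[THEN carrier_matD(1), symmetric] this]
  \<comment> \<open>In order: the carriers of \<open>P\<close> and \<open>R\<close>,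
    \<open>P * R = 1\<close>, \<open>R * P = 1\<close>, and \<open>?M = P * T * R\<close>.\<close>
  note PR = wit(6,7,1,2,3)
  \<comment> \<open>The diagonal of a triangular matrix consists of roots of its characteristic
    polynomial, which similarity preserves.\<close>
  have "Re (T $$ (i, i)) < 0" if i: "i < n" for i
  proof -
    have "poly (char_poly T) (T $$ (i, i)) = 0"
      using i T(1) by (subst char_poly_upper_triangular[OF T(1,2)])
        (auto simp: diag_mat_def poly_prod_list prod_list_zero_iff)
    then have "T $$ (i, i) \<in> spectrum ?M"
      using eigenvalue_root_char_poly[OF M'] char_poly_similar[OF T(3)] by (simp add: spectrum_def)
    then show ?thesis using spec by (auto simp: complex_spectrum_def open_left_half_plane_def)
  qed
  moreover have "T $$ (i, j) = 0" if "i < n" "j < i" for i j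
    using upper_triangularD[OF T(2)] that T(1) by simp
  ultimately obtain w \<alpha> where w: "\<And>i. w i > 0" and \<alpha>: "\<alpha> > 0" and diss:
    "\<And>y. (\<Sum>i<n. w i * Re (cnj (y i) * (\<Sum>j<n. T $$ (i, j) * y j)))
        \<le> - \<alpha> * (\<Sum>i<n. w i * (cmod (y i))\<^sup>2)"
    using upper_triangular_weighted_dissipation[of n "\<lambda>i j. T $$ (i, j)"] by blast
  define V where "V x = (\<Sum>i<n. w i * (cmod ((R *\<^sub>v map_vec of_real x) $ i))\<^sup>2)" for x
  have V0: "V x \<ge> 0" for x unfolding V_def using w by (intro sum_nonneg) (simp add: less_imp_le)
  \<comment> \<open>\<open>d\<close> bounds the squared norm of \<open>x = P y\<close> by
    \<open>V x\<close>, the sum of \<open>1 / w j\<close> undoing the weights; \<open>c\<close>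
    bounds \<open>V x\<close> through \<open>R\<close>. Adding 1 later makes both constants strictly
    positive.\<close>
  define d where "d = (\<Sum>i<n. (\<Sum>j<n. cmod (P $$ (i, j)))\<^sup>2 * (\<Sum>j<n. 1 / w j))"
  define c where "c = (\<Sum>i<n. w i * (\<Sum>j<n. cmod (R $$ (i, j)))\<^sup>2)"
  have d0: "d \<ge> 0" unfolding d_def using w
    by (intro sum_nonneg mult_nonneg_nonneg) (auto simp: less_imp_le)
  have c0: "c \<ge> 0" unfolding c_def using w by (intro sum_nonneg mult_nonneg_nonneg) (auto simp: less_imp_le)
  show ?thesis
  proof (rule that[of R \<alpha> "d + 1" "c + 1" w])
    fix x :: "real vec" assume x: "x \<in> carrier_vec n"
    let ?x = "map_vec complex_of_real x" and ?y = "R *\<^sub>v map_vec complex_of_real x"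
    have x': "?x \<in> carrier_vec n" using x by simp
    then have y: "?y \<in> carrier_vec n" using PR(2) by simp
    \<comment> \<open>Since \<open>R * ?M = T * R\<close>, the velocity \<open>M x\<close> has Schur
      coordinates \<open>T y\<close>, so \<open>diss\<close> applies.\<close>
    have "R *\<^sub>v map_vec complex_of_real (M *\<^sub>v x) = R *\<^sub>v (?M *\<^sub>v ?x)"
      by (rule arg_cong[OF of_real_hom.mult_mat_vec_hom[OF M x]])
    also have "\<dots> = (R * ?M) *\<^sub>v ?x" using PR(2) M' x' by simp
    also have "R * ?M = R * P * T * R"
      unfolding PR(5) using PR(1,2) T(1) by (simp add: assoc_mult_mat[of _ n n _ n _ n])
    also have "\<dots> = T * R" using T(1) by (simp add: PR(4))
    also have "T * R *\<^sub>v ?x = T *\<^sub>v ?y" using T(1) PR(2) x' by simp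
    finally have "(R *\<^sub>v map_vec complex_of_real (M *\<^sub>v x)) $ i = (\<Sum>j<n. T $$ (i, j) * ?y $ j)"
      if "i < n" for i using that mult_mat_vec_index[OF T(1) y] by simp
    then show "(\<Sum>i<n. w i * Re (cnj (?y $ i) * (R *\<^sub>v map_vec of_real (M *\<^sub>v x)) $ i))
         \<le> - \<alpha> * (\<Sum>i<n. w i * (cmod (?y $ i))\<^sup>2)"
      using diss[of "\<lambda>i. ?y $ i"] by simp
    have xP: "P *\<^sub>v ?y = ?x"
      using assoc_mult_mat_vec[OF PR(1,2) x'] PR(3) x' by simp
    \<comment> \<open>One weighted term is at most \<open>V x\<close>; replacing
      \<open>1 / w j\<close> by the full sum makes the bound independent of
      \<open>j\<close>.\<close>
    have yV: "(cmod (?y $ j))\<^sup>2 \<le> (\<Sum>j<n. 1 / w j) * V x" if "j < n" for j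
    proof -
      have "w j * (cmod (?y $ j))\<^sup>2 \<le> V x" unfolding V_def
        using that w by (intro member_le_sum[of j _ "\<lambda>i. w i * (cmod (?y $ i))\<^sup>2"]) (auto simp: less_imp_le)
      then have "(cmod (?y $ j))\<^sup>2 \<le> (1 / w j) * V x" using w[of j] by (simp add: field_simps)
      also have "\<dots> \<le> (\<Sum>j<n. 1 / w j) * V x"
        using that w V0 by (intro mult_right_mono member_le_sum[of j _ "\<lambda>i. 1 / w i"]) (auto simp: less_imp_le)
      finally show ?thesis .
    qed
    have "(euclid_norm x)\<^sup>2 = (\<Sum>i<n. (cmod (?x $ i))\<^sup>2)" using x by (simp add: euclid_norm_sq)
    also have "\<dots> = (\<Sum>i<n. (cmod (\<Sum>j<n. P $$ (i, j) * ?y $ j))\<^sup>2)"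
      using mult_mat_vec_index[OF PR(1) y] by (simp add: xP)
    also have "\<dots> \<le> (\<Sum>i<n. (\<Sum>j<n. cmod (P $$ (i, j)))\<^sup>2 * ((\<Sum>j<n. 1 / w j) * V x))"
      using yV by (intro sum_mono cmod_sum_mult_sq_le) auto
    also have "\<dots> = d * V x" by (simp add: d_def sum_distrib_right mult.assoc)
    also have "\<dots> \<le> (d + 1) * V x" using V0 by (intro mult_right_mono) auto
    finally show "(euclid_norm x)\<^sup>2 \<le> (d + 1) * (\<Sum>i<n. w i * (cmod (?y $ i))\<^sup>2)"
      by (simp add: V_def)
    have xj: "(cmod (?x $ j))\<^sup>2 \<le> (euclid_norm x)\<^sup>2" if "j < n" for j
      using that x member_le_sum[of j "{..<n}" "\<lambda>i. (x $ i)\<^sup>2"] by (simp add: euclid_norm_sq)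
    have "V x = (\<Sum>i<n. w i * (cmod (\<Sum>j<n. R $$ (i, j) * ?x $ j))\<^sup>2)"
      unfolding V_def using mult_mat_vec_index[OF PR(2) x'] by simp
    also have "\<dots> \<le> (\<Sum>i<n. w i * ((\<Sum>j<n. cmod (R $$ (i, j)))\<^sup>2 * (euclid_norm x)\<^sup>2))"
      using xj w by (intro sum_mono mult_left_mono cmod_sum_mult_sq_le) (auto simp: less_imp_le)
    also have "\<dots> = c * (euclid_norm x)\<^sup>2" by (simp add: c_def sum_distrib_right mult.assoc)
    also have "\<dots> \<le> (c + 1) * (euclid_norm x)\<^sup>2" by (intro mult_right_mono) auto
    finally show "(\<Sum>i<n. w i * (cmod (?y $ i))\<^sup>2) \<le> (c + 1) * (euclid_norm x)\<^sup>2"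
      by (simp add: V_def)
  qed (use PR \<alpha> c0 d0 in auto)
qed

section \<open>Existence of solutions by the exponential series\<close>

text \<open>The series is treated one coordinate at a time, so convergence and termwise
  differentiation are those of scalar power series.\<close>

lemma linear_ode_solution_exists:
  assumes M: "M \<in> carrier_mat n n" and x0: "x0 \<in> carrier_vec n"
  shows "\<exists>x. is_solution n ((*\<^sub>v) M) x \<and> x 0 = x0"
proof -
  define p where "p k = ((*\<^sub>v) M ^^ k) x0" for k
  have p: "p k \<in> carrier_vec n" for k
    by (induction k) (use M x0 in \<open>auto simp: p_def\<close>)
  have p_Suc: "p (Suc k) $ i = (\<Sum>j<n. M $$ (i, j) * p k $ j)" if "i < n" for k i
    using mult_mat_vec_index[OF M p that] by (simp add: p_def)
  \<comment> \<open>\<open>K\<close> dominates every absolute row sum, so each application of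
    \<open>M\<close> multiplies a uniform coordinate bound by at most \<open>K\<close>;
    \<open>X\<close> is such a bound for \<open>x0\<close>.\<close>
  define K where "K = (\<Sum>i<n. \<Sum>j<n. \<bar>M $$ (i, j)\<bar>)"
  define X where "X = (\<Sum>i<n. \<bar>x0 $ i\<bar>)"
  have K0: "K \<ge> 0" and X0: "X \<ge> 0" unfolding K_def X_def by (auto intro!: sum_nonneg)
  have row_le: "(\<Sum>j<n. \<bar>M $$ (i, j)\<bar>) \<le> K" if "i < n" for i
    unfolding K_def
    using that by (intro member_le_sum[of i _ "\<lambda>i. \<Sum>j<n. \<bar>M $$ (i, j)\<bar>"]) (auto intro: sum_nonneg)
  have bound: "\<bar>p k $ i\<bar> \<le> K ^ k * X" if "i < n" for k i
    using that
  proof (induction k arbitrary: i)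
    case 0
    then show ?case
      unfolding X_def p_def using member_le_sum[of i "{..<n}" "\<lambda>i. \<bar>x0 $ i\<bar>"] by simp
  next
    case (Suc k)
    have "\<bar>p (Suc k) $ i\<bar> \<le> (\<Sum>j<n. \<bar>M $$ (i, j)\<bar> * \<bar>p k $ j\<bar>)"
      unfolding p_Suc[OF Suc.prems] abs_mult[symmetric] by (rule sum_abs)
    also have "\<dots> \<le> (\<Sum>j<n. \<bar>M $$ (i, j)\<bar> * (K ^ k * X))"
      using Suc.IH by (intro sum_mono mult_left_mono) auto
    also have "\<dots> = (\<Sum>j<n. \<bar>M $$ (i, j)\<bar>) * (K ^ k * X)" by (rule sum_distrib_right[symmetric])
    also have "\<dots> \<le> K * (K ^ k * X)"
      using row_le[OF Suc.prems] K0 X0 by (intro mult_right_mono) auto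
    finally show ?case by simp
  qed
  define c where "c i k = p k $ i / fact k" for i k
  have summ: "summable (\<lambda>k. c i k * t ^ k)" if "i < n" for i and t :: real
  proof (rule summable_comparison_test')
    show "summable (\<lambda>k. X * (inverse (fact k) * (K * \<bar>t\<bar>) ^ k))"
      by (intro summable_mult summable_exp)
    fix k :: nat
    have "norm (c i k * t ^ k) = \<bar>p k $ i\<bar> * (inverse (fact k) * \<bar>t\<bar> ^ k)"
      by (simp add: c_def abs_mult power_abs divide_inverse)
    also have "\<dots> \<le> K ^ k * X * (inverse (fact k) * \<bar>t\<bar> ^ k)"
      using bound[OF that] by (intro mult_right_mono) auto
    also have "\<dots> = X * (inverse (fact k) * (K * \<bar>t\<bar>) ^ k)" by (simp add: power_mult_distrib)
    finally show "norm (c i k * t ^ k) \<le> X * (inverse (fact k) * (K * \<bar>t\<bar>) ^ k)" .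
  qed
  define x where "x t = vec n (\<lambda>i. \<Sum>k. c i k * t ^ k)" for t :: real
  have x: "x t \<in> carrier_vec n" for t by (simp add: x_def)
  \<comment> \<open>Differentiation turns \<open>fact (Suc k)\<close> into \<open>fact k\<close>, so
    the new coefficients are \<open>M\<close> applied to the old ones.\<close>
  have diffs_c: "diffs (c i) k = (\<Sum>j<n. M $$ (i, j) * c j k)" if "i < n" for i k
  proof -
    have "diffs (c i) k = p (Suc k) $ i / fact k"
      by (simp add: diffs_def c_def del: of_nat_Suc)
    then show ?thesis by (simp add: p_Suc[OF that] sum_divide_distrib c_def)
  qed
  have "((\<lambda>s. x s $ i) has_real_derivative (M *\<^sub>v x t) $ i) (at t within {0..})" if i: "i < n" for i t
  proof -
    have "(\<Sum>k. diffs (c i) k * t ^ k) = (\<Sum>k. \<Sum>j<n. M $$ (i, j) * (c j k * t ^ k))"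
      by (simp add: diffs_c[OF i] sum_distrib_right mult.assoc)
    also have "\<dots> = (\<Sum>j<n. \<Sum>k. M $$ (i, j) * (c j k * t ^ k))"
      by (intro suminf_sum summable_mult summ) simp
    also have "\<dots> = (\<Sum>j<n. M $$ (i, j) * x t $ j)"
      by (intro sum.cong refl) (simp add: x_def suminf_mult summ)
    also have "\<dots> = (M *\<^sub>v x t) $ i" using mult_mat_vec_index[OF M x i] by simp
    finally show ?thesis
      using termdiffs_strong_converges_everywhere[OF summ[OF i], of t] i
      by (simp add: x_def has_field_derivative_at_within)
  qed
  then have "is_solution n ((*\<^sub>v) M) x" using x by (simp add: is_solution_def)
  moreover have "x 0 = x0"
  proof (rule eq_vecI)
    fix i assume "i < dim_vec x0"
    moreover have "c i 0 = x0 $ i" by (simp add: c_def p_def)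
    ultimately show "x 0 $ i = x0 $ i" using x0 by (simp add: x_def powser_zero)
  qed (use x0 in \<open>simp add: x_def\<close>)
  ultimately show ?thesis by blast
qed

section \<open>Exponential decay and asymptotic stability\<close>

text \<open>The constants are fixed before the solution; this uniformity yields stability as well as
  attraction.\<close>

lemma hurwitz_exponential_decay:
  assumes M: "M \<in> carrier_mat n n" and spec: "complex_spectrum M \<subseteq> \<complex>\<^sup>-"
  obtains c \<alpha> :: real where "c > 0" "\<alpha> > 0"
    "\<And>x t. is_solution n ((*\<^sub>v) M) x \<Longrightarrow> t \<ge> 0 \<Longrightarrow>
      euclid_norm (x t) \<le> c * exp (- \<alpha> * t) * euclid_norm (x 0)"
proof -
  obtain R :: "complex mat" and w :: "nat \<Rightarrow> real" and \<alpha> c\<^sub>1 c\<^sub>2 :: real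
    where R: "R \<in> carrier_mat n n" and pos: "\<alpha> > 0" "c\<^sub>1 > 0" "c\<^sub>2 > 0"
    and diss: "\<And>x. x \<in> carrier_vec n \<Longrightarrow>
       (\<Sum>i<n. w i * Re (cnj ((R *\<^sub>v map_vec of_real x) $ i) * (R *\<^sub>v map_vec of_real (M *\<^sub>v x)) $ i))
         \<le> - \<alpha> * (\<Sum>i<n. w i * (cmod ((R *\<^sub>v map_vec of_real x) $ i))\<^sup>2)"
    and lower: "\<And>x. x \<in> carrier_vec n \<Longrightarrow>
       (euclid_norm x)\<^sup>2 \<le> c\<^sub>1 * (\<Sum>i<n. w i * (cmod ((R *\<^sub>v map_vec of_real x) $ i))\<^sup>2)"
    and upper: "\<And>x. x \<in> carrier_vec n \<Longrightarrow>
       (\<Sum>i<n. w i * (cmod ((R *\<^sub>v map_vec of_real x) $ i))\<^sup>2) \<le> c\<^sub>2 * (euclid_norm x)\<^sup>2"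
    by (rule hurwitz_lyapunov[OF M spec]) (rule that)
  show ?thesis
  \<comment> \<open>The norm comparisons concern squares: the root of the product of their constants
    appears, and the rate \<open>2 * \<alpha>\<close> of \<open>V\<close> becomes
    \<open>\<alpha>\<close>.\<close>
  proof (rule that[of "sqrt (c\<^sub>1 * c\<^sub>2)" \<alpha>])
    fix x and t :: real assume sol: "is_solution n ((*\<^sub>v) M) x" and t: "t \<ge> 0"
    have x: "x s \<in> carrier_vec n" if "s \<ge> 0" for s using sol that by (simp add: is_solution_def)
    have dx: "((\<lambda>s. x s $ i) has_real_derivative (M *\<^sub>v x s) $ i) (at s within {0..})"
      if "s \<ge> 0" "i < n" for s i using sol that by (simp add: is_solution_def)
    \<comment> \<open>Explicit sums can be differentiated directly; they are identified with the
      products by \<open>R\<close> for \<open>s \<ge> 0\<close>, where \<open>x s\<close> is known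
      to have dimension \<open>n\<close>.\<close>
    define y where "y s i = (\<Sum>j<n. R $$ (i, j) * of_real (x s $ j))" for s i
    define z where "z s i = (\<Sum>j<n. R $$ (i, j) * of_real ((M *\<^sub>v x s) $ j))" for s i
    have y: "(R *\<^sub>v map_vec of_real (x s)) $ i = y s i"
      and z: "(R *\<^sub>v map_vec of_real (M *\<^sub>v x s)) $ i = z s i" if "s \<ge> 0" "i < n" for s i
      using mult_mat_vec_index[OF R _ that(2)] x[OF that(1)] M by (auto simp: y_def z_def)
    define V where "V s = (\<Sum>i<n. w i * ((Re (y s i))\<^sup>2 + (Im (y s i))\<^sup>2))" for s
    have V: "(\<Sum>i<n. w i * (cmod ((R *\<^sub>v map_vec of_real (x s)) $ i))\<^sup>2) = V s" if "s \<ge> 0" for s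
      using that by (simp add: V_def y cmod_power2)
    \<comment> \<open>The derivative of \<open>V\<close>, because
      \<open>Re y * Re z + Im y * Im z = Re (cnj y * z)\<close>.\<close>
    define V' where "V' s = 2 * (\<Sum>i<n. w i * Re (cnj (y s i) * z s i))" for s
    have V': "V' s \<le> - (2 * \<alpha>) * V s" if "s \<ge> 0" for s
      using diss[OF x[OF that]] that unfolding V[OF that] by (simp add: V'_def y z)
    have dy: "((\<lambda>s. Re (y s i)) has_real_derivative Re (z s i)) (at s within {0..})"
      "((\<lambda>s. Im (y s i)) has_real_derivative Im (z s i)) (at s within {0..})" if "s \<ge> 0" for s i
      unfolding y_def z_def Re_sum Im_sum Re_complex_of_real Im_complex_of_real times_complex.sel
      using that by (auto intro!: derivative_eq_intros dx simp: mult.commute)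
    have dV: "(V has_real_derivative V' s) (at s within {0..})" if "s \<ge> 0" for s
      unfolding V_def V'_def
      by (rule derivative_eq_intros dy that refl)+
        (simp add: sum_distrib_left algebra_simps power2_eq_square)
    \<comment> \<open>The integrating factor turns \<open>V' \<le> - (2 * \<alpha>) * V\<close> into
      monotonicity of \<open>g\<close>.\<close>
    define g where "g s = exp (2 * \<alpha> * s) * V s" for s
    have dg: "(g has_real_derivative exp (2 * \<alpha> * s) * (2 * \<alpha> * V s + V' s)) (at s within {0..})"
      if "s \<ge> 0" for s
      unfolding g_def
      by (rule derivative_eq_intros dV that refl)+ (simp add: algebra_simps)
    have "g t \<le> g 0"
    proof (rule DERIV_nonpos_imp_decreasing_open[OF t])
      fix s :: real assume s: "0 < s" "s < t"
      \<comment> \<open>At interior points the derivative within the half-line is the ordinary one;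
        at 0 continuity suffices.\<close>
      have "at s within {0..} = at s"
        using s by (intro at_within_nhd[of s "{0<..}"]) auto
      then show "\<exists>y. DERIV g s :> y \<and> y \<le> 0"
        using dg[of s] V'[of s] s by (auto intro!: exI mult_nonneg_nonpos)
    next
      show "continuous_on {0..t} g"
        by (rule continuous_on_subset[of "{0..}"], rule DERIV_continuous_on[OF dg]) auto
    qed
    then have "exp (2 * \<alpha> * t) * V t \<le> V 0" by (simp add: g_def)
    then have Vt: "V t \<le> (exp (- \<alpha> * t))\<^sup>2 * V 0"
      by (simp add: exp_double[symmetric] exp_minus field_simps)
    have "(euclid_norm (x t))\<^sup>2 \<le> c\<^sub>1 * V t" using lower[OF x[OF t]] V[OF t] by simp
    also have "\<dots> \<le> c\<^sub>1 * ((exp (- \<alpha> * t))\<^sup>2 * V 0)" using Vt pos by (intro mult_left_mono) auto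
    also have "\<dots> \<le> c\<^sub>1 * ((exp (- \<alpha> * t))\<^sup>2 * (c\<^sub>2 * (euclid_norm (x 0))\<^sup>2))"
      using upper[OF x[of 0]] V[of 0] pos by (intro mult_left_mono) auto
    also have "\<dots> = (sqrt (c\<^sub>1 * c\<^sub>2) * exp (- \<alpha> * t) * euclid_norm (x 0))\<^sup>2"
      using pos by (simp add: power_mult_distrib)
    finally show "euclid_norm (x t) \<le> sqrt (c\<^sub>1 * c\<^sub>2) * exp (- \<alpha> * t) * euclid_norm (x 0)"
      by (rule power2_le_imp_le) (use pos in \<open>simp add: euclid_norm_nonneg\<close>)
  qed (use pos in auto)
qed

lemma hurwitz_globally_asymptotically_stable:
  assumes M: "M \<in> carrier_mat n n" and spec: "complex_spectrum M \<subseteq> \<complex>\<^sup>-"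
  shows "globally_asymptotically_stable n ((*\<^sub>v) M) (0\<^sub>v n)"
proof -
  obtain c \<alpha> :: real where c: "c > 0" and \<alpha>: "\<alpha> > 0" and decay:
    "\<And>x t. is_solution n ((*\<^sub>v) M) x \<Longrightarrow> t \<ge> 0 \<Longrightarrow>
      euclid_norm (x t) \<le> c * exp (- \<alpha> * t) * euclid_norm (x 0)"
    using hurwitz_exponential_decay[OF M spec] by blast
  have sub0: "x t - 0\<^sub>v n = x t" if "is_solution n ((*\<^sub>v) M) x" "t \<ge> 0" for x t
    using that by (auto simp: is_solution_def intro!: eq_vecI)
  show ?thesis
    unfolding globally_asymptotically_stable_def
  proof (intro conjI allI impI ballI)
    show "M *\<^sub>v 0\<^sub>v n = 0\<^sub>v n" using M by auto
  next
    fix x0 :: "real vec" assume "x0 \<in> carrier_vec n"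
    then show "\<exists>x. is_solution n ((*\<^sub>v) M) x \<and> x 0 = x0" by (rule linear_ode_solution_exists[OF M])
  next
    fix \<epsilon> :: real assume \<epsilon>: "\<epsilon> > 0"
    show "\<exists>\<delta>>0. \<forall>x. is_solution n ((*\<^sub>v) M) x \<longrightarrow> euclid_norm (x 0 - 0\<^sub>v n) < \<delta> \<longrightarrow>
        (\<forall>t\<ge>0. euclid_norm (x t - 0\<^sub>v n) < \<epsilon>)"
    \<comment> \<open>The exponential factor is at most 1 for \<open>t \<ge> 0\<close>, so only
      \<open>c\<close> enters \<delta>.\<close>
    proof (intro exI[of _ "\<epsilon> / c"] conjI allI impI)
      fix x and t :: real
      assume sol: "is_solution n ((*\<^sub>v) M) x" and le: "euclid_norm (x 0 - 0\<^sub>v n) < \<epsilon> / c" and t: "t \<ge> 0"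
      have "euclid_norm (x t) \<le> c * exp (- \<alpha> * t) * euclid_norm (x 0)" by (rule decay[OF sol t])
      also have "\<dots> \<le> c * 1 * euclid_norm (x 0)"
        using c \<alpha> t euclid_norm_nonneg by (intro mult_right_mono mult_left_mono) auto
      also have "\<dots> < \<epsilon>" using le c sub0[OF sol, of 0] by (simp add: field_simps)
      finally show "euclid_norm (x t - 0\<^sub>v n) < \<epsilon>" by (simp add: sub0[OF sol t])
    qed (use \<epsilon> c in auto)
  next
    fix x assume sol: "is_solution n ((*\<^sub>v) M) x"
    have "((\<lambda>t. exp (- \<alpha> * t)) \<longlongrightarrow> 0) at_top"
      by (rule filterlim_compose[OF exp_at_bot],
          rule filterlim_tendsto_neg_mult_at_bot[OF tendsto_const _ filterlim_ident]) (use \<alpha> in simp)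
    then have "((\<lambda>t. c * exp (- \<alpha> * t) * euclid_norm (x 0)) \<longlongrightarrow> c * 0 * euclid_norm (x 0)) at_top"
      by (intro tendsto_intros)
    then have lim: "((\<lambda>t. c * exp (- \<alpha> * t) * euclid_norm (x 0)) \<longlongrightarrow> 0) at_top" by simp
    have "\<forall>\<^sub>F t in at_top. euclid_norm (x t - 0\<^sub>v n) \<le> c * exp (- \<alpha> * t) * euclid_norm (x 0)"
      using eventually_ge_at_top[of "0::real"]
    proof eventually_elim
      case (elim t)
      then show ?case unfolding sub0[OF sol elim] by (rule decay[OF sol])
    qed
    then show "((\<lambda>t. euclid_norm (x t - 0\<^sub>v n)) \<longlongrightarrow> 0) at_top"
      by (rule tendsto_sandwich[OF always_eventually[OF allI[OF euclid_norm_nonneg]] _ tendsto_const lim])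
  qed simp
qed

section \<open>The feedback matrix and the closed loop\<close>

text \<open>Positive definiteness excludes kernel vectors, so \<open>mat_inverse\<close> returns
  \<open>Some\<close>; for \<open>None\<close> the dimensions of \<open>mat_inv\<close> would be
  unspecified.\<close>

lemma mat_inv_carrier:
  assumes "sym_positive_definite n A"
  shows "mat_inv A \<in> carrier_mat n n"
proof -
  have A: "A \<in> carrier_mat n n" using assms by (simp add: sym_positive_definite_def)
  have "det A \<noteq> 0"
  proof
    assume "det A = 0"
    then obtain v where v: "v \<in> carrier_vec n" "v \<noteq> 0\<^sub>v n" "A *\<^sub>v v = 0\<^sub>v n"
      using det_0_iff_vec_prod_zero_field[OF A] by blast
    then have "v \<bullet> (A *\<^sub>v v) = 0" by simp
    then show False using assms v by (force simp: sym_positive_definite_def)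
  qed
  then have "A \<in> Units (ring_mat TYPE(real) n ())" by (rule det_non_zero_imp_unit[OF A])
  then obtain B where "mat_inverse A = Some B" using mat_inverse(1)[OF A, where b="()"] by (cases "mat_inverse A") auto
  then show ?thesis using mat_inverse(2)[OF A] by (simp add: mat_inv_def)
qed

lemma Fd_mat_carrier:
  assumes H: "hierarchical_network N" and D: "distributed_control_law N C Quu Q"
  shows "Fd_mat N Quu Q \<in> carrier_mat (2 * n_H N) (3 * n_H N - 1)"
proof -
  have s: "set (node_order N) = nodes N" and len: "length (node_order N) = n_H N"
    using H by (auto simp: hierarchical_network_def n_H_def distinct_card[symmetric])
  have "dim_row (Fd_blk N Quu Q i) = 2 \<and> dim_col (Fd_blk N Quu Q i) = local_dim N i"
    if "i \<in> set (node_order N)" for i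
    using D that mat_inv_carrier[of 2 "Quu i"] unfolding s distributed_control_law_def
    by (auto simp: Fd_blk_def sym_positive_definite_def)
  then have "map dim_row (map (Fd_blk N Quu Q) (node_order N)) = map (\<lambda>_. 2) (node_order N)"
    "map dim_col (map (Fd_blk N Quu Q) (node_order N)) = map (local_dim N) (node_order N)"
    by auto
  then show ?thesis
    using sum_local_dim[OF H] len
    by (intro carrier_matI) (simp_all only: Fd_mat_def dim_diag_block_mat sum_list_triv mult.commute[of 2] of_nat_id)
qed

text \<open>The vector field is only ever evaluated on the carrier: along solutions at
  \<open>t \<ge> 0\<close> and at the equilibrium.\<close>

lemma globally_asymptotically_stable_cong:
  assumes "\<And>x. x \<in> carrier_vec n \<Longrightarrow> f x = g x"
  shows "globally_asymptotically_stable n f p \<longleftrightarrow> globally_asymptotically_stable n g p"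
proof -
  have "is_solution n f = is_solution n g"
    unfolding is_solution_def using assms by (intro ext) auto
  then show ?thesis
    unfolding globally_asymptotically_stable_def using assms[of p] by auto
qed

theorem mainTheorem2:
  fixes N :: "'v network" and C Quu Q :: "'v \<Rightarrow> real mat"
  assumes "hierarchical_network N"
    and "connected_lossless N"
    and "bounded_angle_differences N"
    and "positive_parameters N"
    and "synchronous_state N"
    and "distributed_control_law N C Quu Q"
    and "complex_spectrum (A_tilde N + B_mat N * Fd_mat N Quu Q) \<subseteq> \<complex>\<^sup>-"
  shows "globally_asymptotically_stable (3 * n_H N - 1)
           (\<lambda>x. A_tilde N *\<^sub>v x + B_mat N *\<^sub>v (Fd_mat N Quu Q *\<^sub>v x))
           (0\<^sub>v (3 * n_H N - 1))"
proof -
  note A = system_matrix_carriers(1)[OF assms(1)]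
  note B = system_matrix_carriers(2)[OF assms(1)]
  note F = Fd_mat_carrier[OF assms(1,6)]
  \<comment> \<open>Regrouping into a single matrix relies on matching dimensions, hence holds on
    the carrier only.\<close>
  have "A_tilde N *\<^sub>v x + B_mat N *\<^sub>v (Fd_mat N Quu Q *\<^sub>v x)
      = (A_tilde N + B_mat N * Fd_mat N Quu Q) *\<^sub>v x" if "x \<in> carrier_vec (3 * n_H N - 1)" for x
    using add_mult_distrib_mat_vec[OF A mult_carrier_mat[OF B F] that] assoc_mult_mat_vec[OF B F that]
    by simp
  then show ?thesis
    using hurwitz_globally_asymptotically_stable[OF add_carrier_mat[OF mult_carrier_mat[OF B F]] assms(7)]
    by (subst globally_asymptotically_stable_cong[where g = "(*\<^sub>v) (A_tilde N + B_mat N * Fd_mat N Quu Q)"])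
      auto
qed

end
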